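(* There exist a non-abelian group $G_0$ with the unique product property and a constant $\gamma>0$ such that the following holds for every integer $k\ge 1$. If $c\ge 0$ is a number such that $|AB|>|A|+|B|+k$ holds for all finite subsets $A,B\subset G_0$ for which $A$ is not contained in a left coset of any cyclic subgroup of $G_0$ and $|B|>c$, then $c\ge\gamma k^2$.
   Context: Groups are written multiplicatively. For finite subsets $A,B$ of a group, $AB=\{ab:\ a\in A,\ b\in B\}$, and $|\cdot|$ denotes the cardinality of a finite set. A left coset of a subgroup $H\le G$ is a set of the form $gH$ with $g\in G$. A group $G$ has the unique product property (is a unique product group) if for every pair of finite non-empty sets $X,Y\subset G$ there is an element $g\in XY$ which can be represented in exactly one way in the form $g=xy$ with $x\in X$ and $y\in Y$. *)

theory Defs
  imports Complex_Main "HOL-Algebra.Algebra"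
begin

definition unique_product_group :: "('a, 'b) monoid_scheme \<Rightarrow> bool" where
  "unique_product_group G \<longleftrightarrow> group G \<and>
     (\<forall>S T. S \<subseteq> carrier G \<longrightarrow> T \<subseteq> carrier G \<longrightarrow> finite S \<longrightarrow> finite T \<longrightarrow> S \<noteq> {} \<longrightarrow> T \<noteq> {} \<longrightarrow>
        (\<exists>g \<in> S <#>\<^bsub>G\<^esub> T. \<exists>!p. p \<in> S \<times> T \<and> g = fst p \<otimes>\<^bsub>G\<^esub> snd p))"

definition cyclic_subgroup :: "'a set \<Rightarrow> ('a, 'b) monoid_scheme \<Rightarrow> bool" where
  "cyclic_subgroup H G \<longleftrightarrow> subgroup H G \<and> cyclic_group (G\<lparr>carrier := H\<rparr>)"

definition in_cyclic_left_coset :: "('a, 'b) monoid_scheme \<Rightarrow> 'a set \<Rightarrow> bool" where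
  "in_cyclic_left_coset G A \<longleftrightarrow>
     (\<exists>H. cyclic_subgroup H G \<and> (\<exists>g \<in> carrier G. A \<subseteq> g <#\<^bsub>G\<^esub> H))"

text \<open>
  \<open>sumset_bound G k c\<close> is the hypothesis on the number \<open>c\<close> for a given \<open>k\<close>.

  The main statement asserts the existence of a group; HOL cannot quantify over types, so the
  witness is required to have its elements in \<^typ>\<open>nat\<close>, i.e. to be countable. This loses
  nothing. Suppose \<open>G\<close> is any witness. Whether \<open>sumset_bound G k c\<close> holds depends only on \<open>k\<close>
  and the integer part of \<open>c\<close>, so countably many pairs of finite sets \<open>(A, B)\<close> refute all
  false instances. The subgroup generated by these sets and two non-commuting elements is
  countable, inherits the unique product property, and the same pairs refute the same instances
  in it: a cyclic subgroup of a subgroup of \<open>G\<close> is a cyclic subgroup of \<open>G\<close>.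
\<close>

definition sumset_bound :: "('a, 'b) monoid_scheme \<Rightarrow> nat \<Rightarrow> real \<Rightarrow> bool" where
  "sumset_bound G k c \<longleftrightarrow>
     (\<forall>A B. A \<subseteq> carrier G \<longrightarrow> B \<subseteq> carrier G \<longrightarrow> finite A \<longrightarrow> finite B \<longrightarrow>
        \<not> in_cyclic_left_coset G A \<longrightarrow> real (card B) > c \<longrightarrow>
        card (A <#>\<^bsub>G\<^esub> B) > card A + card B + k)"

end

(* In a left-ordered group the largest element of ST is uniquely represented, since its second factor
   must be max T. The Klein bottle group is left orderable, non-abelian and contains a copy of \<int>\<^sup>2.
   There take A = {1, x, y} with x, y a basis of \<int>\<^sup>2 and B a triangle with n = k + 2 points on each
   side: AB is contained in the triangle with n + 1 points on each side, so |AB| - |B| is at most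
   n + 1 = |A| + k, while |B| is quadratic in k. *)

theory Submission
  imports Defs "HOL-Library.Nat_Bijection" "HOL-Library.Product_Lexorder"
begin

text \<open>The order is pulled back along \<open>key\<close> because the group used below lives on
  nat, whose built-in order is not the invariant one.\<close>

lemma unique_product_group_if_left_ordered:
  fixes key :: "'a \<Rightarrow> 'o::linorder"
  assumes "group G"
    and inj: "inj_on key (carrier G)"
    and mono: "\<And>x y z. \<lbrakk>x \<in> carrier G; y \<in> carrier G; z \<in> carrier G; key x < key y\<rbrakk>
      \<Longrightarrow> key (z \<otimes>\<^bsub>G\<^esub> x) < key (z \<otimes>\<^bsub>G\<^esub> y)"
  shows "unique_product_group G"
  unfolding unique_product_group_def
proof (intro conjI allI impI)
  interpret group G by fact
  show "group G" by fact
  fix S T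
  assume S: "S \<subseteq> carrier G" "finite S" "S \<noteq> {}" and T: "T \<subseteq> carrier G" "finite T" "T \<noteq> {}"
  have max: "\<exists>x\<in>A. \<forall>y\<in>A. f y \<le> f x" if A: "finite A" "A \<noteq> {}" for A :: "'a set" and f :: "'a \<Rightarrow> 'o"
  proof -
    obtain x where "x \<in> A" "f x = Max (f ` A)"
      using obtains_MAX[OF A, of f] by metis
    then show ?thesis
      using A(1) by (intro bexI[of _ x]) simp_all
  qed
  obtain t0 where t0: "t0 \<in> T" "\<And>t. t \<in> T \<Longrightarrow> key t \<le> key t0"
    using max[OF T(2,3)] by blast
  \<comment> \<open>Only left multiplication is monotone, so \<open>s0\<close> is chosen to maximise
    the product with \<open>t0\<close>; it need not be the largest element of
    \<open>S\<close>.\<close>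
  obtain s0 where s0: "s0 \<in> S" "\<And>s. s \<in> S \<Longrightarrow> key (s \<otimes>\<^bsub>G\<^esub> t0) \<le> key (s0 \<otimes>\<^bsub>G\<^esub> t0)"
    using max[OF S(2,3), of "\<lambda>s. key (s \<otimes>\<^bsub>G\<^esub> t0)"] by blast
  have "s = s0 \<and> t = t0" if st: "s \<in> S" "t \<in> T" and eq: "s0 \<otimes>\<^bsub>G\<^esub> t0 = s \<otimes>\<^bsub>G\<^esub> t" for s t
  proof -
    have carr: "s \<in> carrier G" "t \<in> carrier G" "s0 \<in> carrier G" "t0 \<in> carrier G"
      using st s0(1) t0(1) S(1) T(1) by blast+
    \<comment> \<open>Otherwise, in the order given by \<open>key\<close>, s t < s t0 \<le> s0 t0 =
      s t.\<close>
    have "\<not> key t < key t0"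
      using mono[OF carr(2,4,1)] s0(2)[OF st(1)] unfolding eq by (metis leD)
    then have "key t = key t0"
      using t0(2)[OF st(2)] by simp
    then have "t = t0"
      using carr by (intro inj_onD[OF inj])
    then show ?thesis
      using eq carr by simp
  qed
  then have "\<exists>!p. p \<in> S \<times> T \<and> s0 \<otimes>\<^bsub>G\<^esub> t0 = fst p \<otimes>\<^bsub>G\<^esub> snd p"
    using s0(1) t0(1) by (intro ex1I[of _ "(s0, t0)"]) (simp, metis SigmaE fst_conv snd_conv)
  moreover have "s0 \<otimes>\<^bsub>G\<^esub> t0 \<in> S <#>\<^bsub>G\<^esub> T"
    using s0(1) t0(1) unfolding set_mult_def by blast
  ultimately show "\<exists>g\<in>S <#>\<^bsub>G\<^esub> T. \<exists>!p. p \<in> S \<times> T \<and> g = fst p \<otimes>\<^bsub>G\<^esub> snd p"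
    by blast
qed

lemma in_cyclic_left_coset_imp_cyclic:
  assumes "group G" "in_cyclic_left_coset G A" "\<one>\<^bsub>G\<^esub> \<in> A"
  obtains h where "h \<in> carrier G" "A \<subseteq> range (\<lambda>i::int. h [^]\<^bsub>G\<^esub> i)"
proof -
  interpret group G by fact
  obtain H g where H: "subgroup H G" "cyclic_group (G\<lparr>carrier := H\<rparr>)"
    and g: "g \<in> carrier G" "A \<subseteq> g <#\<^bsub>G\<^esub> H"
    using assms(2) unfolding in_cyclic_left_coset_def cyclic_subgroup_def by auto
  interpret H: subgroup H G by fact
  \<comment> \<open>A left coset containing the identity is the subgroup itself.\<close>
  have "g <#\<^bsub>G\<^esub> H = \<one>\<^bsub>G\<^esub> <#\<^bsub>G\<^esub> H"
    using g assms(3) l_repr_independence[of "\<one>\<^bsub>G\<^esub>" g H] H(1) by auto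
  then have "A \<subseteq> H"
    using g(2) lcos_mult_one[OF H.subset] by simp
  moreover obtain h where h: "h \<in> H" "H = range (\<lambda>i::int. h [^]\<^bsub>G\<lparr>carrier := H\<rparr>\<^esub> i)"
    using H(2) unfolding group.cyclic_group[OF subgroup.subgroup_is_group[OF H(1) assms(1)]]
    by auto
  ultimately have "A \<subseteq> range (\<lambda>i::int. h [^]\<^bsub>G\<^esub> i)"
    by (simp add: int_pow_consistent[OF H(1) h(1)])
  then show thesis by (rule that[OF H.mem_carrier[OF h(1)]])
qed

text \<open>
  The pair \<open>(m, a)\<close> stands for \<open>t\<^sup>m y\<^sup>a\<close> in the group with the relation \<open>t\<^sup>-\<^sup>1 y t = y\<^sup>-\<^sup>1\<close>. With the power of
  \<open>t\<close> in front, the lexicographic order is left invariant. As \<open>t\<^sup>2\<close> is central, \<open>t\<^sup>2\<close> and \<open>y\<close> span a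
  copy of \<open>\<int>\<^sup>2\<close>.
\<close>

definition klein_mult :: "int \<times> int \<Rightarrow> int \<times> int \<Rightarrow> int \<times> int" where
  "klein_mult p q = (fst p + fst q, (if even (fst q) then snd p else - snd p) + snd q)"

text \<open>The theorem asks for a group on nat, so the multiplication of pairs is carried over
  along a bijection.\<close>

definition klein_encode :: "int \<times> int \<Rightarrow> nat" where
  "klein_encode p = prod_encode (int_encode (fst p), int_encode (snd p))"

definition klein_decode :: "nat \<Rightarrow> int \<times> int" where
  "klein_decode n = map_prod int_decode int_decode (prod_decode n)"

definition klein_group :: "nat monoid" where
  "klein_group = \<lparr>carrier = UNIV,
     monoid.mult = \<lambda>x y. klein_encode (klein_mult (klein_decode x) (klein_decode y)),
     one = klein_encode (0, 0)\<rparr>"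

lemma klein_decode_encode [simp]: "klein_decode (klein_encode p) = p"
  by (simp add: klein_decode_def klein_encode_def)

lemma klein_encode_decode [simp]: "klein_encode (klein_decode n) = n"
  by (cases "prod_decode n") (simp add: klein_decode_def klein_encode_def, metis prod_decode_inverse)

lemma inj_klein_encode: "inj klein_encode"
  by (rule inj_on_inverseI[where g = klein_decode]) simp

lemma inj_klein_decode: "inj klein_decode"
  by (rule inj_on_inverseI[where g = klein_encode]) simp

lemma klein_group_simps [simp]:
  "carrier klein_group = UNIV"
  "x \<otimes>\<^bsub>klein_group\<^esub> y = klein_encode (klein_mult (klein_decode x) (klein_decode y))"
  "\<one>\<^bsub>klein_group\<^esub> = klein_encode (0, 0)"
  by (simp_all add: klein_group_def)

lemma group_klein: "group klein_group"
proof (rule groupI)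
  fix x
  let ?p = "klein_decode x"
  \<comment> \<open>The inverse of t^m y^a is y^(-a) t^(-m); moving the power of t to the front
    flips the sign of the exponent of y when m is odd.\<close>
  let ?y = "klein_encode (- fst ?p, if even (fst ?p) then - snd ?p else snd ?p)"
  have "?y \<otimes>\<^bsub>klein_group\<^esub> x = \<one>\<^bsub>klein_group\<^esub>"
    by (simp add: klein_mult_def)
  then show "\<exists>y\<in>carrier klein_group. y \<otimes>\<^bsub>klein_group\<^esub> x = \<one>\<^bsub>klein_group\<^esub>"
    by (metis UNIV_I klein_group_simps(1))
qed (simp_all add: klein_mult_def algebra_simps)

lemma unique_product_group_klein: "unique_product_group klein_group"
proof (rule unique_product_group_if_left_ordered[OF group_klein, where key = klein_decode])
  show "inj_on klein_decode (carrier klein_group)"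
    using inj_klein_decode by simp
next
  fix x y z
  assume "klein_decode x < klein_decode y"
  then show "klein_decode (z \<otimes>\<^bsub>klein_group\<^esub> x) < klein_decode (z \<otimes>\<^bsub>klein_group\<^esub> y)"
    \<comment> \<open>If the first coordinates of x and y agree, the second coordinate of z enters
      both products with the same sign, so both second coordinates shift equally; otherwise the
      first coordinates decide.\<close>
    by (cases "klein_decode x"; cases "klein_decode y") (auto simp: klein_mult_def)
qed

lemma not_comm_group_klein: "\<not> comm_group klein_group"
proof
  assume "comm_group klein_group"
  then interpret comm_group klein_group .
  have "klein_encode (1, 0) \<otimes>\<^bsub>klein_group\<^esub> klein_encode (0, 1)
      = klein_encode (0, 1) \<otimes>\<^bsub>klein_group\<^esub> klein_encode (1, 0)"
    by (rule m_comm) auto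
  then show False
    by (simp add: klein_mult_def inj_eq[OF inj_klein_encode])
qed

text \<open>The exponent of t is a homomorphism to the integers.\<close>

lemma fst_klein_decode_int_pow:
  "fst (klein_decode (x [^]\<^bsub>klein_group\<^esub> (i::int))) = i * fst (klein_decode x)"
proof -
  have "group_hom klein_group integer_group (\<lambda>x. fst (klein_decode x))"
    by (intro group_hom.intro group_hom_axioms.intro group_klein group_integer_group)
      (auto simp: hom_def klein_mult_def integer_group_def)
  from group_hom.hom_int_pow[OF this, of x i] show ?thesis
    unfolding group_int_pow_integer_group by (simp only: klein_group_simps UNIV_I mult.commute)
qed

definition corner :: "nat set" where
  "corner = klein_encode ` {(0, 0), (2, 0), (0, 1)}"

lemma card_corner: "card corner = 3"
  unfolding corner_def by (subst card_image[OF inj_on_subset[OF inj_klein_encode]]) auto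

text \<open>If 1, t^2 and y were powers of one h, then t^2 would force a nonzero exponent of t in h,
  so y, where this exponent is zero, could only be the zeroth power of h.\<close>

lemma corner_not_in_cyclic_left_coset: "\<not> in_cyclic_left_coset klein_group corner"
proof
  assume "in_cyclic_left_coset klein_group corner"
  moreover have "\<one>\<^bsub>klein_group\<^esub> \<in> corner" by (simp add: corner_def)
  ultimately obtain h where h: "corner \<subseteq> range (\<lambda>i::int. h [^]\<^bsub>klein_group\<^esub> i)"
    by (rule in_cyclic_left_coset_imp_cyclic[OF group_klein])
  obtain i j :: int where i: "klein_encode (2, 0) = h [^]\<^bsub>klein_group\<^esub> i"
    and j: "klein_encode (0, 1) = h [^]\<^bsub>klein_group\<^esub> j"
    using h unfolding corner_def by blast
  have "2 = i * fst (klein_decode h)" "0 = j * fst (klein_decode h)"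
    using fst_klein_decode_int_pow[of h i] fst_klein_decode_int_pow[of h j]
    unfolding i[symmetric] j[symmetric] by simp_all
  then have "j = 0" by auto
  with j have "klein_encode (0, 1) = klein_encode (0, 0)"
    by simp
  then show False
    by (simp add: inj_eq[OF inj_klein_encode])
qed

text \<open>Only even powers of t occur, so these points multiply by adding the coordinates (i,
  j).\<close>

definition triangle :: "nat \<Rightarrow> nat set" where
  "triangle n = (\<lambda>(i, j). klein_encode (2 * int i, int j)) ` (SIGMA i:{..<n}. {..<n - i})"

lemma finite_triangle: "finite (triangle n)"
  unfolding triangle_def by auto

lemma card_triangle: "card (triangle n) = (\<Sum>i<n. n - i)"
proof -
  have "inj (\<lambda>(i, j). klein_encode (2 * int i, int j))"
    by (auto intro!: injI simp: inj_eq[OF inj_klein_encode])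
  then show ?thesis
    unfolding triangle_def by (subst card_image) (auto intro: inj_on_subset)
qed

lemma card_triangle_Suc: "card (triangle (Suc n)) = card (triangle n) + Suc n"
  \<comment> \<open>The column i = 0 has n + 1 points; the other columns form the smaller
    triangle.\<close>
  unfolding card_triangle by (subst sum.lessThan_Suc_shift) simp

lemma card_triangle_ge: "n * n \<le> 2 * card (triangle n)"
  by (induction n) (simp_all add: card_triangle_Suc)

text \<open>Each element of \<open>corner\<close> raises i + j by at most one.\<close>

lemma corner_mult_triangle: "corner <#>\<^bsub>klein_group\<^esub> triangle n \<subseteq> triangle (Suc n)"
proof -
  have mem: "klein_encode (a, b) \<in> triangle (Suc n)"
    if "a = 2 * int i" "b = int j" "i + j \<le> n" for a b i j
    unfolding triangle_def using that by (intro image_eqI[of _ _ "(i, j)"]) auto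
  have "x \<otimes>\<^bsub>klein_group\<^esub> y \<in> triangle (Suc n)" if xy: "x \<in> corner" "y \<in> triangle n" for x y
  proof -
    obtain i j where y: "y = klein_encode (2 * int i, int j)" "i + j < n"
      using xy(2) unfolding triangle_def by auto
    from xy(1) consider "x = klein_encode (0, 0)" | "x = klein_encode (2, 0)"
      | "x = klein_encode (0, 1)"
      unfolding corner_def by blast
    then show ?thesis
    proof cases
      case 1
      then show ?thesis using y by (simp add: klein_mult_def mem[of _ i _ j])
    next
      case 2
      then show ?thesis using y by (simp add: klein_mult_def mem[of _ "Suc i" _ j])
    next
      case 3
      then show ?thesis using y by (simp add: klein_mult_def mem[of _ i _ "Suc j"])
    qed
  qed
  then show ?thesis
    unfolding set_mult_def by blast
qed

theorem mainTheorem4: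
  shows "\<exists>(G\<^sub>0 :: nat monoid) (\<gamma> :: real).
    unique_product_group G\<^sub>0 \<and> \<not> comm_group G\<^sub>0 \<and> \<gamma> > 0 \<and>
    (\<forall>k::nat. k \<ge> 1 \<longrightarrow>
      (\<forall>c::real. c \<ge> 0 \<longrightarrow> sumset_bound G\<^sub>0 k c \<longrightarrow> c \<ge> \<gamma> * (real k)\<^sup>2))"
proof (intro exI[of _ klein_group] exI[of _ "1/2 :: real"] conjI allI impI)
  fix k :: nat and c :: real
  assume bound: "sumset_bound klein_group k c"
  \<comment> \<open>Enlarging this triangle by one adds k + 3 points, exactly
    \<open>card corner + k\<close>, so the strict inequality in \<open>sumset_bound\<close>
    fails.\<close>
  let ?B = "triangle (k + 2)"
  have "card (corner <#>\<^bsub>klein_group\<^esub> ?B) \<le> card (triangle (Suc (k + 2)))"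
    by (intro card_mono finite_triangle corner_mult_triangle)
  also have "\<dots> = card corner + card ?B + k"
    by (simp only: card_triangle_Suc card_corner)
  finally have "\<not> real (card ?B) > c"
    using bound corner_not_in_cyclic_left_coset finite_triangle[of "k + 2"]
    unfolding sumset_bound_def
    \<comment> \<open>Finiteness of \<open>corner\<close> follows from its nonzero cardinality, as
      infinite sets have \<open>card\<close> 0.\<close>
    by (metis card_corner card.infinite klein_group_simps(1) leD subset_UNIV zero_neq_numeral)
  \<comment> \<open>This estimate is the source of the constant 1/2.\<close>
  moreover have "(real k)\<^sup>2 \<le> 2 * real (card ?B)"
  proof -
    have "k * k \<le> 2 * card ?B"
      using card_triangle_ge[of "k + 2"] mult_le_mono[of k "k + 2" k "k + 2"] by linarith
    then have "real (k * k) \<le> real (2 * card ?B)"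
      by (rule of_nat_mono)
    then show ?thesis by (simp add: power2_eq_square)
  qed
  ultimately show "c \<ge> 1 / 2 * (real k)\<^sup>2" by simp
qed (simp_all add: unique_product_group_klein not_comm_group_klein)

end
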